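(* Let $\alpha,\beta>0$, $z>0$, $0<q\le1$ and $\gamma\ge q$. For every integer $n\ge0$, $$E_{\alpha,\beta}^{\gamma,q,n}(z)\,E_{\alpha,\beta}^{\gamma,q,n+2}(z)\le\left(E_{\alpha,\beta}^{\gamma,q,n+1}(z)\right)^2 .$$ For $q=1$, the condition $\gamma\ge1$ cannot be relaxed uniformly in $\alpha,\beta$.
   Context: For $\alpha,\beta,\gamma,q>0$, put $$a_k=\frac{(\gamma)_{qk}}{k!\,\Gamma(\alpha k+\beta)},\qquad (\gamma)_{qk}=\frac{\Gamma(\gamma+qk)}{\Gamma(\gamma)},\qquad k\ge0.$$ The Prabhakar function is $E_{\alpha,\beta}^{\gamma,q}(z)=\sum_{k\ge0}a_kz^k$, for $z>0$ in the domain of convergence, and its remainders are $$E_{\alpha,\beta}^{\gamma,q,n}(z)=\sum_{k\ge n+1}a_kz^k,\qquad n\ge0 .$$ *)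

theory Defs
  imports "HOL-Analysis.Analysis"
begin

text \<open>
  The generalized Pochhammer symbol has a real index; it agrees with the library's
  \<^const>\<open>pochhammer\<close> when \<open>s\<close> is a natural number.
\<close>

definition gen_pochhammer :: "real \<Rightarrow> real \<Rightarrow> real" where
  "gen_pochhammer \<gamma> s = Gamma (\<gamma> + s) / Gamma \<gamma>"

definition prabhakar_coeff :: "real \<Rightarrow> real \<Rightarrow> real \<Rightarrow> real \<Rightarrow> nat \<Rightarrow> real" where
  "prabhakar_coeff \<alpha> \<beta> \<gamma> q k =
     gen_pochhammer \<gamma> (q * real k) / (fact k * Gamma (\<alpha> * real k + \<beta>))"

text \<open>
  The sum over \<open>k \<ge> n + 1\<close> is reindexed to start at zero. For \<open>\<alpha>, \<beta>, \<gamma> > 0\<close> and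
  \<open>0 < q \<le> 1\<close> consecutive coefficients have quotient of order \<open>k powr (q - 1 - \<alpha>)\<close>,
  so the series converges for every \<open>z\<close>.
\<close>

definition prabhakar_remainder ::
    "real \<Rightarrow> real \<Rightarrow> real \<Rightarrow> real \<Rightarrow> nat \<Rightarrow> real \<Rightarrow> real" where
  "prabhakar_remainder \<alpha> \<beta> \<gamma> q n z =
     (\<Sum>k. prabhakar_coeff \<alpha> \<beta> \<gamma> q (k + (n + 1)) * z ^ (k + (n + 1)))"

end

theory Submission
  imports Defs
begin

text \<open>
  The inequality is log-concavity of the sequence of remainders at a fixed argument. It is
  inherited from the terms of the series: if the quotients \<open>b (k + 1) / b k\<close> of a positive
  summable sequence decrease, then comparing \<open>b (m + 1) / b m\<close> with all later quotients shows
  that the tails are log-concave as well (\<open>tails_logconcave\<close>). The power of \<open>z\<close> multiplies every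
  quotient by the same constant, so only the coefficients matter. Their quotient is the product
  of \<open>\<Gamma>(x + q) / (\<Gamma>(x) (k + 1))\<close> with \<open>x = \<gamma> + q k\<close> and
  \<open>\<Gamma>(\<alpha> k + \<beta>) / \<Gamma>(\<alpha> k + \<beta> + \<alpha>)\<close>. The second factor decreases because \<open>\<Gamma>\<close> is log-convex.
  The first one equals \<open>\<Gamma>(x + q) / \<Gamma>(x + 1) \<cdot> (q + (\<gamma> - q) / (k + 1))\<close>; here the Gamma quotient
  decreases for \<open>q \<le> 1\<close>, again by log-convexity, and the bracket decreases for \<open>\<gamma> \<ge> q\<close>.

  For the sharpness at \<open>q = 1\<close>, two limits remove the parameters. Divided by suitable powers
  of \<open>z\<close>, the remainders tend to their leading coefficients as \<open>z \<rightarrow> 0\<close>, so the inequality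
  with \<open>n = 0\<close> forces \<open>a\<^sub>1 a\<^sub>3 \<le> a\<^sub>2\<^sup>2\<close>. With \<open>\<beta> = 1\<close> and \<open>\<alpha> \<rightarrow> 0\<close> the factors
  \<open>\<Gamma>(\<alpha> k + \<beta>)\<close> tend to \<open>1\<close>, which leaves \<open>(\<gamma> + 2) / 3 \<le> (\<gamma> + 1) / 2\<close>, that is, \<open>\<gamma> \<ge> 1\<close>.
\<close>

section \<open>Quotients of Gamma values\<close>

text \<open>
  Log-convexity of \<open>\<Gamma>\<close>: the points \<open>x + s\<close> and \<open>y\<close> lie between \<open>x\<close> and \<open>y + s\<close> and have the
  same sum.
\<close>

lemma Gamma_shift_mult_le:
  fixes x y s :: real
  assumes "0 < x" "x \<le> y" "0 \<le> s"
  shows "Gamma (x + s) * Gamma y \<le> Gamma x * Gamma (y + s)"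
proof (cases "y + s = x")
  case True
  then have "s = 0" "y = x" using assms by auto
  then show ?thesis by simp
next
  case False
  define t where "t = s / (y + s - x)"
  have d: "y + s - x > 0" using False assms by simp
  have t: "0 \<le> t" "t \<le> 1" using assms d by (auto simp: t_def field_simps)
  have td: "t * (y + s - x) = s" using d by (simp add: t_def)
  have e1: "(1 - t) *\<^sub>R x + t *\<^sub>R (y + s) = x + s" using td by (simp add: algebra_simps)
  have e2: "(1 - (1 - t)) *\<^sub>R x + (1 - t) *\<^sub>R (y + s) = y" using td by (simp add: algebra_simps)
  have c1: "ln (Gamma (x + s)) \<le> (1 - t) * ln (Gamma x) + t * ln (Gamma (y + s))"
    using convex_onD[OF log_convex_Gamma_real, of t x "y + s"] t assms unfolding e1 by simp
  have c2: "ln (Gamma y) \<le> (1 - (1 - t)) * ln (Gamma x) + (1 - t) * ln (Gamma (y + s))"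
    using convex_onD[OF log_convex_Gamma_real, of "1 - t" x "y + s"] t assms unfolding e2 by simp
  have pos: "0 < Gamma x" "0 < Gamma y" "0 < Gamma (x + s)" "0 < Gamma (y + s)"
    using assms by simp_all
  have "ln (Gamma (x + s)) + ln (Gamma y) \<le> ln (Gamma x) + ln (Gamma (y + s))"
    using c1 c2 by (simp add: algebra_simps)
  then have "ln (Gamma (x + s) * Gamma y) \<le> ln (Gamma x * Gamma (y + s))"
    using pos by (simp add: ln_mult_pos)
  then show ?thesis
    using pos by (subst (asm) ln_le_cancel_iff) auto
qed

lemma Gamma_shift_quotient_antimono:
  fixes x y s :: real
  assumes "0 < x" "x \<le> y" "0 \<le> s"
  shows "Gamma y / Gamma (y + s) \<le> Gamma x / Gamma (x + s)"
  using Gamma_shift_mult_le[OF assms] assms by (simp add: field_simps)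

text \<open>
  If \<open>\<Gamma>(y + \<alpha>) / \<Gamma>(y)\<close> were bounded by \<open>C\<close>, then \<open>m\<close> steps of size \<open>\<alpha>\<close> with \<open>m \<alpha> \<ge> 1\<close> would
  bound \<open>\<Gamma>(y + m \<alpha>) / \<Gamma>(y)\<close> by \<open>C\<^sup>m\<close>; but one unit step already contributes the factor \<open>y\<close>.
  Since the quotient is monotone, exceeding \<open>C\<close> once is enough.
\<close>

lemma Gamma_shift_quotient_unbounded:
  fixes \<alpha> C :: real
  assumes "0 < \<alpha>" "0 < C"
  obtains y0 where "0 < y0" "\<And>y. y0 \<le> y \<Longrightarrow> C * Gamma y \<le> Gamma (y + \<alpha>)"
proof -
  have "\<exists>y0>0. C * Gamma y0 \<le> Gamma (y0 + \<alpha>)"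
  proof (rule ccontr)
    assume "\<not> ?thesis"
    then have bd: "Gamma (y + \<alpha>) \<le> C * Gamma y" if "y > 0" for y
      using that by (meson linear)
    have pow: "Gamma (y + real m * \<alpha>) \<le> C ^ m * Gamma y" if "y > 0" for y m
    proof (induction m)
      case (Suc m)
      have "Gamma (y + real (Suc m) * \<alpha>) = Gamma ((y + real m * \<alpha>) + \<alpha>)"
        by (simp add: algebra_simps)
      also have "\<dots> \<le> C * Gamma (y + real m * \<alpha>)"
        using that assms by (intro bd) (simp add: add_pos_nonneg)
      also have "\<dots> \<le> C * (C ^ m * Gamma y)" using Suc assms by simp
      finally show ?case by simp
    qed simp
    obtain m :: nat where m: "1 / \<alpha> \<le> real m" using real_arch_simple by blast
    define s where "s = real m * \<alpha> - 1"
    have s: "s \<ge> 0" using m assms by (simp add: s_def field_simps)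
    have le: "y * Gamma (1 + s) \<le> C ^ m" if "y > 0" for y
    proof -
      have "Gamma (1 + s) * Gamma (y + 1) \<le> Gamma 1 * Gamma (y + 1 + s)"
        using Gamma_shift_mult_le[of 1 "y + 1" s] that s by simp
      also have "\<dots> = Gamma (y + real m * \<alpha>)" by (simp add: s_def add.assoc)
      also have "\<dots> \<le> C ^ m * Gamma y" using that by (rule pow)
      finally have "(y * Gamma (1 + s)) * Gamma y \<le> C ^ m * Gamma y"
        using that by (subst (asm) Gamma_plus1) (auto elim!: nonpos_Ints_cases simp: mult_ac)
      then show ?thesis using that by (simp add: mult_le_cancel_right)
    qed
    have "Gamma (1 + s) > 0" using s by simp
    then show False
      using le[of "(C ^ m + 1) / Gamma (1 + s)"] assms by (simp add: add_pos_pos)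
  qed
  then obtain y0 where y0: "y0 > 0" "C * Gamma y0 \<le> Gamma (y0 + \<alpha>)" by blast
  have "C * Gamma y \<le> Gamma (y + \<alpha>)" if "y0 \<le> y" for y
  proof -
    have "C * Gamma y0 * Gamma y \<le> Gamma (y0 + \<alpha>) * Gamma y"
      using y0 that by (intro mult_right_mono) auto
    also have "\<dots> \<le> Gamma y0 * Gamma (y + \<alpha>)"
      using y0 that assms by (intro Gamma_shift_mult_le) auto
    finally have "Gamma y0 * (C * Gamma y) \<le> Gamma y0 * Gamma (y + \<alpha>)"
      by (simp add: mult_ac)
    then show ?thesis using y0 by (simp add: mult_le_cancel_left)
  qed
  with y0 that show thesis by blast
qed

section \<open>The coefficients\<close>

lemma prabhakar_coeff_pos:
  assumes "0 < \<alpha>" "0 < \<beta>" "0 < \<gamma>" "0 < q"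
  shows "0 < prabhakar_coeff \<alpha> \<beta> \<gamma> q k"
  using assms by (simp add: prabhakar_coeff_def gen_pochhammer_def add_pos_nonneg add_nonneg_pos)

text \<open>
  Replacing \<open>\<Gamma>(x)\<close> by \<open>\<Gamma>(x + 1) / x\<close>, with \<open>x = \<gamma> + q k\<close>, isolates the dependence on the sign
  of \<open>\<gamma> - q\<close> in the middle factor, which is \<open>x / (k + 1)\<close>.
\<close>

lemma prabhakar_coeff_quotient:
  assumes "0 < \<alpha>" "0 < \<beta>" "0 < \<gamma>" "0 < q"
  shows "prabhakar_coeff \<alpha> \<beta> \<gamma> q (Suc k) / prabhakar_coeff \<alpha> \<beta> \<gamma> q k =
    Gamma (\<gamma> + q * real k + q) / Gamma (\<gamma> + q * real k + 1) *
    (q + (\<gamma> - q) / real (Suc k)) *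
    (Gamma (\<alpha> * real k + \<beta>) / Gamma (\<alpha> * real k + \<beta> + \<alpha>))"
proof -
  define x where "x = \<gamma> + q * real k"
  define u where "u = \<alpha> * real k + \<beta>"
  have pos: "x > 0" "u > 0"
    using assms by (simp_all add: x_def u_def add_pos_nonneg add_nonneg_pos)
  have G: "Gamma (x + 1) = x * Gamma x"
    using pos by (intro Gamma_plus1) (auto elim!: nonpos_Ints_cases)
  have mid: "q + (\<gamma> - q) / real (Suc k) = x / real (Suc k)"
    by (simp add: x_def field_simps)
  have e: "\<gamma> + q * real (Suc k) = x + q" "\<alpha> * real (Suc k) + \<beta> = u + \<alpha>"
    by (simp_all add: x_def u_def algebra_simps)
  have nz: "Gamma x > 0" "Gamma u > 0" "Gamma (u + \<alpha>) > 0" "Gamma \<gamma> > 0"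
    using pos assms by simp_all
  show ?thesis
    unfolding prabhakar_coeff_def gen_pochhammer_def e mid x_def[symmetric] u_def[symmetric] G
    using nz pos by (simp add: field_simps del: of_nat_Suc)
qed

lemma Gamma_shift_le_one_quotient_antimono:
  fixes x y q :: real
  assumes "0 < x" "x \<le> y" "0 < q" "q \<le> 1"
  shows "Gamma (y + q) / Gamma (y + 1) \<le> Gamma (x + q) / Gamma (x + 1)"
  using Gamma_shift_quotient_antimono[of "x + q" "y + q" "1 - q"] assms by simp

lemma decseq_prabhakar_coeff_quotient:
  assumes "0 < \<alpha>" "0 < \<beta>" "0 < q" "q \<le> 1" "q \<le> \<gamma>"
  shows "decseq (\<lambda>k. prabhakar_coeff \<alpha> \<beta> \<gamma> q (Suc k) / prabhakar_coeff \<alpha> \<beta> \<gamma> q k)"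
proof (rule decseq_SucI)
  fix k :: nat
  have \<gamma>: "0 < \<gamma>" using assms by simp
  let ?x = "\<gamma> + q * real k" and ?y = "\<gamma> + q * real (Suc k)"
  let ?u = "\<alpha> * real k + \<beta>" and ?v = "\<alpha> * real (Suc k) + \<beta>"
  have x: "0 < ?x" "?x \<le> ?y" and u: "0 < ?u" "?u \<le> ?v" and v: "0 < ?v" "0 < ?v + \<alpha>"
    using assms \<gamma> by (simp_all add: add_pos_nonneg add_nonneg_pos algebra_simps)
  have "(Gamma (?y + q) / Gamma (?y + 1)) * (q + (\<gamma> - q) / real (Suc (Suc k))) *
        (Gamma ?v / Gamma (?v + \<alpha>))
      \<le> (Gamma (?x + q) / Gamma (?x + 1)) * (q + (\<gamma> - q) / real (Suc k)) *
        (Gamma ?u / Gamma (?u + \<alpha>))"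
  proof (intro mult_mono)
    show "Gamma (?y + q) / Gamma (?y + 1) \<le> Gamma (?x + q) / Gamma (?x + 1)"
      using x assms by (intro Gamma_shift_le_one_quotient_antimono) auto
    show "q + (\<gamma> - q) / real (Suc (Suc k)) \<le> q + (\<gamma> - q) / real (Suc k)"
      using assms by (intro add_left_mono divide_left_mono) auto
    show "Gamma ?v / Gamma (?v + \<alpha>) \<le> Gamma ?u / Gamma (?u + \<alpha>)"
      using u assms by (intro Gamma_shift_quotient_antimono) auto
  qed (use x u v assms in \<open>auto intro!: mult_nonneg_nonneg divide_nonneg_nonneg add_nonneg_nonneg
         Gamma_real_nonneg simp del: of_nat_Suc\<close>)
  then show "prabhakar_coeff \<alpha> \<beta> \<gamma> q (Suc (Suc k)) / prabhakar_coeff \<alpha> \<beta> \<gamma> q (Suc k)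
      \<le> prabhakar_coeff \<alpha> \<beta> \<gamma> q (Suc k) / prabhakar_coeff \<alpha> \<beta> \<gamma> q k"
    by (simp only: prabhakar_coeff_quotient[OF assms(1,2) \<gamma> assms(3)])
qed

text \<open>
  The first two factors of the coefficient quotient stay bounded for every \<open>\<gamma> > 0\<close>, and the
  third one tends to \<open>0\<close>, so the radius of convergence is infinite.
\<close>

lemma summable_prabhakar:
  fixes z :: real
  assumes "0 < \<alpha>" "0 < \<beta>" "0 < \<gamma>" "0 < q" "q \<le> 1"
  shows "summable (\<lambda>k. prabhakar_coeff \<alpha> \<beta> \<gamma> q k * z ^ k)"
proof -
  let ?a = "prabhakar_coeff \<alpha> \<beta> \<gamma> q"
  define M where "M = Gamma (\<gamma> + q) / Gamma (\<gamma> + 1) * (q + \<gamma>)"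
  have M: "M > 0" using assms by (simp add: M_def)
  \<comment> \<open>This constant makes the quotient of consecutive terms at most \<open>1/2\<close> in the end.\<close>
  define C where "C = 2 * M * (\<bar>z\<bar> + 1)"
  have C: "C > 0" using M by (simp add: C_def)
  obtain y0 where y0: "0 < y0" "\<And>y. y0 \<le> y \<Longrightarrow> C * Gamma y \<le> Gamma (y + \<alpha>)"
    using Gamma_shift_quotient_unbounded[OF assms(1) C] by blast
  obtain N :: nat where N: "y0 / \<alpha> \<le> real N" using real_arch_simple by blast
  show ?thesis
  proof (rule summable_ratio_test[of "1/2" N])
    fix k assume k: "N \<le> k"
    let ?x = "\<gamma> + q * real k" and ?u = "\<alpha> * real k + \<beta>"
    have x: "\<gamma> \<le> ?x" and u: "?u > 0"
      using assms by (simp_all add: add_nonneg_pos)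
    have "y0 \<le> \<alpha> * real N" using N assms by (simp add: field_simps)
    also have "\<dots> \<le> ?u" using k assms by (simp add: add_increasing2)
    finally have yu: "y0 \<le> ?u" .
    have third: "Gamma ?u / Gamma (?u + \<alpha>) \<le> 1 / C"
      using y0(2)[OF yu] C u assms by (simp add: field_simps)
    have frac: "(\<gamma> - q) / real (Suc k) \<le> \<gamma>"
    proof -
      have "\<gamma> - q \<le> \<gamma> * real (Suc k)" using assms by (simp add: algebra_simps add_increasing)
      then show ?thesis by (simp add: divide_le_eq)
    qed
    have nonneg: "0 \<le> q + (\<gamma> - q) / real (Suc k)"
      using assms by (simp add: field_simps)
    have first: "Gamma (?x + q) / Gamma (?x + 1) \<le> Gamma (\<gamma> + q) / Gamma (\<gamma> + 1)"
      using x assms by (intro Gamma_shift_le_one_quotient_antimono) auto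
    have "?a (Suc k) / ?a k \<le> M * (1 / C)"
      unfolding prabhakar_coeff_quotient[OF assms(1-4)] M_def
      using first frac third nonneg x u assms
      by (intro mult_mono)
         (auto intro!: mult_nonneg_nonneg divide_nonneg_nonneg Gamma_real_nonneg simp del: of_nat_Suc)
    also have "M * (1 / C) = 1 / (2 * (\<bar>z\<bar> + 1))" using M by (simp add: C_def)
    finally have "?a (Suc k) \<le> 1 / (2 * (\<bar>z\<bar> + 1)) * ?a k"
      using prabhakar_coeff_pos[OF assms(1-4), of k] by (simp only: pos_divide_le_eq)
    then have "?a (Suc k) * \<bar>z\<bar> \<le> 1 / (2 * (\<bar>z\<bar> + 1)) * ?a k * \<bar>z\<bar>"
      by (rule mult_right_mono) simp
    also have "\<dots> = 1 / 2 * ?a k * (\<bar>z\<bar> / (\<bar>z\<bar> + 1))" by simp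
    also have "\<dots> \<le> 1 / 2 * ?a k * 1"
      using prabhakar_coeff_pos[OF assms(1-4), of k] by (intro mult_left_mono) auto
    finally have "?a (Suc k) * \<bar>z\<bar> * \<bar>z\<bar> ^ k \<le> 1 / 2 * ?a k * 1 * \<bar>z\<bar> ^ k"
      by (rule mult_right_mono) simp
    then show "norm (?a (Suc k) * z ^ Suc k) \<le> 1 / 2 * norm (?a k * z ^ k)"
      using prabhakar_coeff_pos[OF assms(1-4)]
      by (simp add: abs_mult power_abs less_imp_le mult.assoc)
  qed simp
qed

section \<open>Tails of log-concave series\<close>

text \<open>
  Write \<open>U = T (n + 1)\<close> and \<open>V = T (n + 2)\<close> for the tails \<open>T m\<close> starting at index \<open>m\<close>. Since
  \<open>T n = b n + U\<close> and \<open>U = b (n + 1) + V\<close>, the claim reduces to \<open>b n \<cdot> V \<le> b (n + 1) \<cdot> U\<close>,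
  which holds term by term.
\<close>

lemma tails_logconcave:
  fixes b :: "nat \<Rightarrow> real"
  assumes pos: "\<And>k. 0 < b k" and dec: "decseq (\<lambda>k. b (Suc k) / b k)" and sm: "summable b"
  shows "(\<Sum>k. b (k + n)) * (\<Sum>k. b (k + (n + 2))) \<le> (\<Sum>k. b (k + (n + 1)))\<^sup>2"
proof -
  define U where "U = (\<Sum>k. b (k + (n + 1)))"
  define V where "V = (\<Sum>k. b (k + (n + 2)))"
  have s: "summable (\<lambda>k. b (k + m))" for m using sm by (rule summable_ignore_initial_segment)
  have T: "(\<Sum>k. b (k + n)) = b n + U"
    using suminf_split_head[OF s[of n]] by (simp add: U_def)
  have U: "U = b (n + 1) + V"
    using suminf_split_head[OF s[of "n + 1"]] by (simp add: U_def V_def)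
  have step: "b n * b (k + (n + 2)) \<le> b (n + 1) * b (k + (n + 1))" for k
  proof -
    have "b (Suc (k + (n + 1))) / b (k + (n + 1)) \<le> b (Suc n) / b n"
      by (rule decseqD[OF dec]) simp
    then show ?thesis using pos[of n] pos[of "k + (n + 1)"] by (simp add: field_simps)
  qed
  have "b n * V = (\<Sum>k. b n * b (k + (n + 2)))"
    unfolding V_def by (rule suminf_mult[symmetric]) (rule s)
  also have "\<dots> \<le> (\<Sum>k. b (n + 1) * b (k + (n + 1)))"
    by (intro suminf_le step summable_mult s)
  also have "\<dots> = b (n + 1) * U"
    unfolding U_def by (rule suminf_mult) (rule s)
  finally have "b n * V \<le> b (n + 1) * U" .
  moreover have "U\<^sup>2 = b (n + 1) * U + V * U"
    by (subst power2_eq_square, subst (1) U) (simp add: algebra_simps)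
  ultimately have "(b n + U) * V \<le> U\<^sup>2" by (simp add: algebra_simps)
  then show ?thesis by (simp add: T U_def V_def)
qed

lemma prabhakar_remainder_logconcave:
  assumes "0 < \<alpha>" "0 < \<beta>" "0 < z" "0 < q" "q \<le> 1" "q \<le> \<gamma>"
  shows "prabhakar_remainder \<alpha> \<beta> \<gamma> q n z * prabhakar_remainder \<alpha> \<beta> \<gamma> q (n + 2) z
    \<le> (prabhakar_remainder \<alpha> \<beta> \<gamma> q (n + 1) z)\<^sup>2"
proof -
  let ?a = "prabhakar_coeff \<alpha> \<beta> \<gamma> q"
  define b where "b = (\<lambda>k. ?a k * z ^ k)"
  have \<gamma>: "0 < \<gamma>" using assms by simp
  have pos: "0 < b k" for k
    using prabhakar_coeff_pos[OF assms(1,2) \<gamma> assms(4)] assms by (simp add: b_def)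
  have quot: "b (Suc k) / b k = z * (?a (Suc k) / ?a k)" for k
    using assms by (simp add: b_def)
  have "decseq (\<lambda>k. b (Suc k) / b k)"
    unfolding quot
    using decseq_prabhakar_coeff_quotient[OF assms(1,2,4,5,6)] assms(3)
    unfolding decseq_def by (meson less_imp_le mult_left_mono)
  moreover have "summable b"
    unfolding b_def using assms \<gamma> by (intro summable_prabhakar)
  ultimately show ?thesis
    using tails_logconcave[of b "n + 1"] pos
    by (simp add: prabhakar_remainder_def b_def)
qed

section \<open>Sharpness for the parameter value one\<close>

lemma prabhakar_remainder_leading_term:
  assumes "0 < \<alpha>" "0 < \<beta>" "0 < \<gamma>" "0 < q" "q \<le> 1"
  shows "((\<lambda>z. prabhakar_remainder \<alpha> \<beta> \<gamma> q n z / z ^ (n + 1))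
    \<longlongrightarrow> prabhakar_coeff \<alpha> \<beta> \<gamma> q (n + 1)) (at 0)"
proof -
  let ?a = "prabhakar_coeff \<alpha> \<beta> \<gamma> q"
  have "((\<lambda>z. prabhakar_remainder \<alpha> \<beta> \<gamma> q n z / z ^ (n + 1)) \<longlongrightarrow> ?a (0 + (n + 1))) (at 0)"
  proof (rule powser_limit_0_strong[of 1 "\<lambda>k. ?a (k + (n + 1))"])
    fix z :: real assume z: "z \<noteq> 0"
    have "summable (\<lambda>k. ?a (k + (n + 1)) * z ^ (k + (n + 1)))"
      by (rule summable_ignore_initial_segment[OF summable_prabhakar[OF assms]])
    then have "(\<lambda>k. ?a (k + (n + 1)) * z ^ (k + (n + 1)))
        sums prabhakar_remainder \<alpha> \<beta> \<gamma> q n z"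
      unfolding prabhakar_remainder_def by (rule summable_sums)
    then have "(\<lambda>k. ?a (k + (n + 1)) * z ^ (k + (n + 1)) / z ^ (n + 1))
        sums (prabhakar_remainder \<alpha> \<beta> \<gamma> q n z / z ^ (n + 1))"
      by (rule sums_divide)
    moreover have "(\<lambda>k. ?a (k + (n + 1)) * z ^ (k + (n + 1)) / z ^ (n + 1))
        = (\<lambda>k. ?a (k + (n + 1)) * z ^ k)"
      using z by (simp add: power_add)
    ultimately show "(\<lambda>k. ?a (k + (n + 1)) * z ^ k)
        sums (prabhakar_remainder \<alpha> \<beta> \<gamma> q n z / z ^ (n + 1))" by simp
  qed simp
  then show ?thesis by simp
qed

lemma coeff_logconcave_if_remainder_logconcave:
  assumes "0 < \<alpha>" "0 < \<beta>" "0 < \<gamma>" "0 < q" "q \<le> 1"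
    and ineq: "\<And>z. 0 < z \<Longrightarrow>
      prabhakar_remainder \<alpha> \<beta> \<gamma> q n z * prabhakar_remainder \<alpha> \<beta> \<gamma> q (n + 2) z
        \<le> (prabhakar_remainder \<alpha> \<beta> \<gamma> q (n + 1) z)\<^sup>2"
  shows "prabhakar_coeff \<alpha> \<beta> \<gamma> q (n + 1) * prabhakar_coeff \<alpha> \<beta> \<gamma> q (n + 3)
    \<le> (prabhakar_coeff \<alpha> \<beta> \<gamma> q (n + 2))\<^sup>2"
proof -
  define F where "F m z = prabhakar_remainder \<alpha> \<beta> \<gamma> q m z / z ^ (m + 1)" for m z
  have lim: "(F m \<longlongrightarrow> prabhakar_coeff \<alpha> \<beta> \<gamma> q (m + 1)) (at_right 0)" for m
    unfolding F_def
    by (rule tendsto_mono[OF _ prabhakar_remainder_leading_term[OF assms(1-5)]])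
       (simp add: at_le)
  have "F n z * F (n + 2) z \<le> (F (n + 1) z)\<^sup>2" if "0 < z" for z
  proof -
    have "F n z * F (n + 2) z = prabhakar_remainder \<alpha> \<beta> \<gamma> q n z *
        prabhakar_remainder \<alpha> \<beta> \<gamma> q (n + 2) z / (z ^ (n + 2))\<^sup>2"
      by (simp add: F_def power2_eq_square field_simps flip: power_add)
    also have "\<dots> \<le> (prabhakar_remainder \<alpha> \<beta> \<gamma> q (n + 1) z)\<^sup>2 / (z ^ (n + 2))\<^sup>2"
      using ineq[OF that] by (rule divide_right_mono) simp
    also have "\<dots> = (F (n + 1) z)\<^sup>2" by (simp add: F_def power_divide)
    finally show ?thesis .
  qed
  then have "eventually (\<lambda>z. F n z * F (n + 2) z \<le> (F (n + 1) z)\<^sup>2) (at_right 0)"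
    by (simp add: eventually_at_right_less eventually_mono[OF eventually_at_right_less])
  from tendsto_le[OF _ tendsto_power[OF lim] tendsto_mult[OF lim lim] this]
  show ?thesis by (simp add: eval_nat_numeral)
qed

lemma prabhakar_coeff_tendsto_alpha_0:
  assumes "0 < \<beta>"
  shows "((\<lambda>\<alpha>. prabhakar_coeff \<alpha> \<beta> \<gamma> q k)
    \<longlongrightarrow> gen_pochhammer \<gamma> (q * real k) / (fact k * Gamma \<beta>)) (at_right 0)"
proof -
  have "((\<lambda>\<alpha>. \<alpha> * real k + \<beta>) \<longlongrightarrow> 0 * real k + \<beta>) (at_right 0)"
    by (intro tendsto_intros)
  then have "((\<lambda>\<alpha>. Gamma (\<alpha> * real k + \<beta>)) \<longlongrightarrow> Gamma \<beta>) (at_right 0)"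
    using assms by (intro tendsto_Gamma) (auto elim!: nonpos_Ints_cases)
  then have "((\<lambda>\<alpha>. fact k * Gamma (\<alpha> * real k + \<beta>)) \<longlongrightarrow> fact k * Gamma \<beta>) (at_right 0)"
    by (rule tendsto_mult_left)
  then show ?thesis
    unfolding prabhakar_coeff_def using Gamma_real_pos[OF assms]
    by (intro tendsto_divide tendsto_const) auto
qed

lemma gen_pochhammer_of_nat:
  assumes "0 < \<gamma>"
  shows "gen_pochhammer \<gamma> (real k) = pochhammer \<gamma> k"
  unfolding gen_pochhammer_def using assms
  by (subst pochhammer_Gamma) (auto elim!: nonpos_Ints_cases)

lemma gamma_ge_1_if_remainder_logconcave:
  assumes "0 < \<gamma>"
    and ineq: "\<And>\<alpha> z. 0 < \<alpha> \<Longrightarrow> 0 < z \<Longrightarrow>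
      prabhakar_remainder \<alpha> 1 \<gamma> 1 0 z * prabhakar_remainder \<alpha> 1 \<gamma> 1 2 z
        \<le> (prabhakar_remainder \<alpha> 1 \<gamma> 1 1 z)\<^sup>2"
  shows "1 \<le> \<gamma>"
proof -
  let ?a = "\<lambda>\<alpha>. prabhakar_coeff \<alpha> 1 \<gamma> 1"
  have lim: "((\<lambda>\<alpha>. ?a \<alpha> k) \<longlongrightarrow> pochhammer \<gamma> k / fact k) (at_right 0)" for k
    using prabhakar_coeff_tendsto_alpha_0[of 1 \<gamma> 1 k] gen_pochhammer_of_nat[OF assms(1)] by simp
  have "?a \<alpha> 1 * ?a \<alpha> 3 \<le> (?a \<alpha> 2)\<^sup>2" if "0 < \<alpha>" for \<alpha>
    using coeff_logconcave_if_remainder_logconcave[of \<alpha> 1 \<gamma> 1 0] ineq that assms(1)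
    by (simp add: numeral_eq_Suc)
  then have "eventually (\<lambda>\<alpha>. ?a \<alpha> 1 * ?a \<alpha> 3 \<le> (?a \<alpha> 2)\<^sup>2) (at_right 0)"
    by (simp add: eventually_mono[OF eventually_at_right_less])
  from tendsto_le[OF _ tendsto_power[OF lim] tendsto_mult[OF lim lim] this]
  have "pochhammer \<gamma> 1 / fact 1 * (pochhammer \<gamma> 3 / fact 3) \<le> (pochhammer \<gamma> 2 / fact 2)\<^sup>2"
    by simp
  then have "\<gamma> * (\<gamma> * (\<gamma> + 1) * (\<gamma> + 2)) / 6 \<le> (\<gamma> * (\<gamma> + 1))\<^sup>2 / 4"
    by (simp add: eval_nat_numeral pochhammer_Suc algebra_simps)
  then have "\<gamma>\<^sup>2 * (\<gamma> + 1) * (\<gamma> + 2) * 2 \<le> \<gamma>\<^sup>2 * (\<gamma> + 1) * (\<gamma> + 1) * 3"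
    by (simp add: power2_eq_square field_simps)
  then have "\<gamma>\<^sup>2 * (\<gamma> + 1) * ((\<gamma> + 2) * 2) \<le> \<gamma>\<^sup>2 * (\<gamma> + 1) * ((\<gamma> + 1) * 3)"
    by (simp only: mult.assoc)
  then have "(\<gamma> + 2) * 2 \<le> (\<gamma> + 1) * 3"
    using assms(1) by (subst (asm) mult_le_cancel_left_pos) auto
  then show ?thesis by simp
qed

theorem theorem3p5:
  shows "(\<forall>(\<alpha>::real) (\<beta>::real) (\<gamma>::real) (q::real) (z::real) (n::nat).
            0 < \<alpha> \<and> 0 < \<beta> \<and> 0 < z \<and> 0 < q \<and> q \<le> 1 \<and> q \<le> \<gamma> \<longrightarrow>
              prabhakar_remainder \<alpha> \<beta> \<gamma> q n z * prabhakar_remainder \<alpha> \<beta> \<gamma> q (n + 2) z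
                \<le> (prabhakar_remainder \<alpha> \<beta> \<gamma> q (n + 1) z)\<^sup>2)
       \<and> (\<forall>\<gamma>::real. 0 < \<gamma> \<and> \<gamma> < 1 \<longrightarrow>
            \<not> (\<forall>(\<alpha>::real) (\<beta>::real) (z::real) (n::nat).
                  0 < \<alpha> \<and> 0 < \<beta> \<and> 0 < z \<longrightarrow>
                    prabhakar_remainder \<alpha> \<beta> \<gamma> 1 n z * prabhakar_remainder \<alpha> \<beta> \<gamma> 1 (n + 2) z
                      \<le> (prabhakar_remainder \<alpha> \<beta> \<gamma> 1 (n + 1) z)\<^sup>2))"
proof (intro conjI allI impI notI)
  fix \<gamma> :: real
  assume \<gamma>: "0 < \<gamma> \<and> \<gamma> < 1"
    and all: "\<forall>\<alpha> \<beta> z n. 0 < \<alpha> \<and> 0 < \<beta> \<and> 0 < z \<longrightarrow>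
      prabhakar_remainder \<alpha> \<beta> \<gamma> 1 n z * prabhakar_remainder \<alpha> \<beta> \<gamma> 1 (n + 2) z
        \<le> (prabhakar_remainder \<alpha> \<beta> \<gamma> 1 (n + 1) z)\<^sup>2"
  have "prabhakar_remainder \<alpha> 1 \<gamma> 1 0 z * prabhakar_remainder \<alpha> 1 \<gamma> 1 2 z
      \<le> (prabhakar_remainder \<alpha> 1 \<gamma> 1 1 z)\<^sup>2" if "0 < \<alpha>" "0 < z" for \<alpha> z
    using all[rule_format, of \<alpha> 1 z 0] that by (simp add: numeral_2_eq_2)
  then have "1 \<le> \<gamma>" using \<gamma> by (intro gamma_ge_1_if_remainder_logconcave) auto
  with \<gamma> show False by simp
qed (blast intro: prabhakar_remainder_logconcave)

end
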